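(* Let $d\ge 2$, $n\ge 2$, and let $\mathcal G=(\mathcal V,\mathcal E)$ be an undirected graph on $\{1,\dots,n\}$ with $m$ edges, an arbitrary orientation with incidence matrix $H$, and $\bar H=H\otimes I_d$. Let $p(t)\in\mathbb R^{dn}$ be a configuration with $\dot p_i=v_i$, the velocities $v_i$ bounded and known, and bearings $g_k(t)=e_k(t)/\|e_k(t)\|$ ($e=\bar Hp$, $e_k\neq0$) measured. If the formation $\mathcal G(p(t))$ is relaxed bearing rigid, then $p(t)$ can be recovered up to a translational vector in $\mathbb R^d$: there is an estimator, driven only by the bearings $g_k(t)$ and velocities $v_i(t)$ and started from arbitrary initial conditions, whose estimate $\hat p(t)$ converges uniformly globally exponentially to $p(t)+1_n\otimes c$ for some constant $c\in\mathbb R^d$.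
   Context: For $y\in\mathbb S^{d-1}$, $\pi_y:=I_d-yy^\top$; $\Pi(t)=\mathrm{blkdiag}(\pi_{g_1(t)},\dots,\pi_{g_m(t)})$; $L=\bar H^\top\bar H$; $L_B(t)=\bar H^\top\Pi(t)\bar H$. $L_B$ is PE if there exist $T,\mu>0$ with $\int_t^{t+T}L_B(\tau)d\tau\ge\mu L$ for all $t$. The formation is bearing persistently exciting (BPE) if $\mathcal G$ has a spanning tree and $L_B$ is PE. The formation is relaxed bearing rigid if it is BPE and its motion is a (time-varying) similarity transformation of an initial configuration, i.e. $p_i(t)=s(t)R(t)^\top p_i(0)+b(t)$ for all $i$ with $s(t)>0$, $R(t)$ a rotation, $b(t)\in\mathbb R^d$. *)

theory Defs
  imports "HOL-Analysis.Analysis"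
begin

(* Conventions.
   Agents are indexed by a finite type 'n (so n = CARD('n)), space dimension by a
   finite type 'd (d = CARD('d)), edges by a finite type 'm (m = CARD('m)).
   A stacked configuration p \<in> R^{dn} is a vector of type real^('n \<times> 'd):
   p $ (i,a) is the a-th coordinate of agent i.  Similarly R^{dm} = real^('m \<times> 'd).
   The (undirected, simple) graph with an arbitrary orientation is given by
   tail/head maps src, dst :: 'm \<Rightarrow> 'n: edge k joins src k and dst k,
   oriented from src k to dst k. *)

definition simple_undirected_graph :: "('m::finite \<Rightarrow> 'n::finite) \<Rightarrow> ('m \<Rightarrow> 'n) \<Rightarrow> bool" where
  "simple_undirected_graph src dst \<longleftrightarrow>
     (\<forall>k. src k \<noteq> dst k) \<and>
     (\<forall>k l. {src k, dst k} = {src l, dst l} \<longrightarrow> k = l)"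

text \<open>Incidence matrix H (m x n) of the orientation: row k has -1 at the tail, +1 at the head,
  so that e_k = p_(dst k) - p_(src k).\<close>
definition incidence :: "('m::finite \<Rightarrow> 'n::finite) \<Rightarrow> ('m \<Rightarrow> 'n) \<Rightarrow> real^'n^'m" where
  "incidence src dst = (\<chi> k i. if i = dst k then 1 else if i = src k then -1 else 0)"

text \<open>Kronecker product A \<otimes> I_d.\<close>
definition kron_id :: "real^'n::finite^'m::finite \<Rightarrow> real^('n \<times> 'd::finite)^('m \<times> 'd)" where
  "kron_id A = (\<chi> ka ib. A $ fst ka $ fst ib * (if snd ka = snd ib then 1 else 0))"

definition Hbar :: "('m::finite \<Rightarrow> 'n::finite) \<Rightarrow> ('m \<Rightarrow> 'n) \<Rightarrow> real^('n \<times> 'd::finite)^('m \<times> 'd)" where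
  "Hbar src dst = kron_id (incidence src dst)"

text \<open>Laplacian L = Hbar^T Hbar.\<close>
definition Lap :: "('m::finite \<Rightarrow> 'n::finite) \<Rightarrow> ('m \<Rightarrow> 'n) \<Rightarrow> real^('n \<times> 'd::finite)^('n \<times> 'd)" where
  "Lap src dst = transpose (Hbar src dst) ** Hbar src dst"

text \<open>Orthogonal projection pi_y = I_d - y y^T.\<close>
definition proj_perp :: "real^'d::finite \<Rightarrow> real^'d^'d" where
  "proj_perp y = mat 1 - (\<chi> a b. y $ a * y $ b)"

text \<open>Block diagonal matrix blkdiag(pi_{g_1},...,pi_{g_m}).\<close>
definition Pi_blk :: "real^'d::finite^'m::finite \<Rightarrow> real^('m \<times> 'd)^('m \<times> 'd)" where
  "Pi_blk g = (\<chi> ka lb. if fst ka = fst lb then proj_perp (g $ fst ka) $ snd ka $ snd lb else 0)"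

text \<open>Bearing Laplacian L_B = Hbar^T Pi Hbar.\<close>
definition bearing_Lap :: "('m::finite \<Rightarrow> 'n::finite) \<Rightarrow> ('m \<Rightarrow> 'n) \<Rightarrow> real^'d::finite^'m \<Rightarrow> real^('n \<times> 'd)^('n \<times> 'd)" where
  "bearing_Lap src dst g = transpose (Hbar src dst) ** Pi_blk g ** Hbar src dst"

text \<open>Edge vectors e = Hbar p, the k-th block e_k, and bearings g_k = e_k / |e_k|.\<close>
definition edge_vec :: "('m::finite \<Rightarrow> 'n::finite) \<Rightarrow> ('m \<Rightarrow> 'n) \<Rightarrow> real^('n \<times> 'd::finite) \<Rightarrow> real^'d^'m" where
  "edge_vec src dst p = (\<chi> k a. (Hbar src dst *v p) $ (k,a))"

definition bearings :: "('m::finite \<Rightarrow> 'n::finite) \<Rightarrow> ('m \<Rightarrow> 'n) \<Rightarrow> real^('n \<times> 'd::finite) \<Rightarrow> real^'d^'m" where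
  "bearings src dst p = (\<chi> k. (1 / norm (edge_vec src dst p $ k)) *\<^sub>R edge_vec src dst p $ k)"

text \<open>Loewner order on square matrices: A \<le> B iff B - A is positive semidefinite.\<close>
definition loewner_le :: "real^'k::finite^'k \<Rightarrow> real^'k^'k \<Rightarrow> bool" where
  "loewner_le A B \<longleftrightarrow> (\<forall>x. 0 \<le> x \<bullet> ((B - A) *v x))"

text \<open>Spanning tree: a set of n-1 edges connecting all vertices.\<close>
definition connects :: "('m::finite \<Rightarrow> 'n::finite) \<Rightarrow> ('m \<Rightarrow> 'n) \<Rightarrow> 'm set \<Rightarrow> bool" where
  "connects src dst S \<longleftrightarrow>
     (\<forall>i j. (i, j) \<in> ({(src k, dst k) | k. k \<in> S} \<union> {(dst k, src k) | k. k \<in> S})\<^sup>*)"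

definition has_spanning_tree :: "('m::finite \<Rightarrow> 'n::finite) \<Rightarrow> ('m \<Rightarrow> 'n) \<Rightarrow> bool" where
  "has_spanning_tree src dst \<longleftrightarrow>
     (\<exists>S. card S = CARD('n) - 1 \<and> connects src dst S)"

text \<open>L_B is persistently exciting (on the time axis t \<ge> 0).\<close>
definition bearing_PE :: "('m::finite \<Rightarrow> 'n::finite) \<Rightarrow> ('m \<Rightarrow> 'n) \<Rightarrow> (real \<Rightarrow> real^('n \<times> 'd::finite)) \<Rightarrow> bool" where
  "bearing_PE src dst p \<longleftrightarrow>
     (\<exists>T \<mu>. T > 0 \<and> \<mu> > 0 \<and>
        (\<forall>t\<ge>0. loewner_le (\<mu> *\<^sub>R Lap src dst)
                  (integral {t..t+T} (\<lambda>\<tau>. bearing_Lap src dst (bearings src dst (p \<tau>))))))"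

definition BPE :: "('m::finite \<Rightarrow> 'n::finite) \<Rightarrow> ('m \<Rightarrow> 'n) \<Rightarrow> (real \<Rightarrow> real^('n \<times> 'd::finite)) \<Rightarrow> bool" where
  "BPE src dst p \<longleftrightarrow> has_spanning_tree src dst \<and> bearing_PE src dst p"

text \<open>Agent i's position p_i in R^d from the stacked vector.\<close>
definition agent :: "real^('n::finite \<times> 'd::finite) \<Rightarrow> 'n \<Rightarrow> real^'d" where
  "agent p i = (\<chi> a. p $ (i,a))"

text \<open>1_n \<otimes> c.\<close>
definition ones_kron :: "real^'d::finite \<Rightarrow> real^('n::finite \<times> 'd)" where
  "ones_kron c = (\<chi> ia. c $ snd ia)"

definition relaxed_bearing_rigid ::
  "('m::finite \<Rightarrow> 'n::finite) \<Rightarrow> ('m \<Rightarrow> 'n) \<Rightarrow> (real \<Rightarrow> real^('n \<times> 'd::finite)) \<Rightarrow> bool" where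
  "relaxed_bearing_rigid src dst p \<longleftrightarrow>
     BPE src dst p \<and>
     (\<exists>s R b. \<forall>t\<ge>0. s t > 0 \<and> rotation_matrix (R t) \<and>
        (\<forall>i. agent (p t) i = s t *\<^sub>R (transpose (R t) *v agent (p 0) i) + b t))"

end

(*
  The estimator is the bearing-only observer  x' = v - L_B(g(t)) x.  The bearing Laplacian
  annihilates the true configuration (pi_(g_k) e_k = 0) and all translations ones_kron c, so the
  error w = x - p - ones_kron c, with c the initial centroid offset, solves
  w' = - Hbar^T Pi(t) Hbar w and keeps zero centroid; on zero-centroid vectors a spanning tree
  gives norm (Hbar w) >= e * norm w.  Along this flow (norm w)^2 decreases at rate
  2 * (norm (Pi Hbar w))^2.  Over a window of length T, Hbar w cannot drift far from its value
  at the start of the window without dissipating energy, so persistent excitation forces the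
  energy to drop by a fixed fraction on every window, which gives uniform exponential decay.
  Solutions exist by Picard iteration, the coefficients being continuous in t.
*)

theory Submission
  imports Defs
begin

declare transpose_matrix_vector [simp del]

section \<open>Matrix-vector products\<close>

lemma bounded_bilinear_matrix_vector_mult:
  "bounded_bilinear ((*v) :: real^'n::finite^'m::finite \<Rightarrow> real^'n \<Rightarrow> real^'m)"
  unfolding bilinear_conv_bounded_bilinear[symmetric] bilinear_def
  by (auto intro!: linearI simp: matrix_vector_right_distrib matrix_vector_mult_add_rdistrib
      matrix_vector_mult_scaleR scaleR_matrix_vector_assoc)

lemma continuous_on_matrix_vector_mult [continuous_intros]:
  fixes A :: "'a::topological_space \<Rightarrow> real^'n::finite^'m::finite"
  shows "continuous_on S A \<Longrightarrow> continuous_on S y \<Longrightarrow> continuous_on S (\<lambda>s. A s *v y s)"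
  by (rule bounded_bilinear.continuous_on[OF bounded_bilinear_matrix_vector_mult])

lemma continuous_on_matrix_mult_sandwich:
  fixes A :: "real^'b::finite^'a::finite" and C :: "real^'d::finite^'c::finite"
  shows "continuous_on S B \<Longrightarrow> continuous_on S (\<lambda>x. A ** B x ** C)"
  by (auto simp: matrix_matrix_mult_def intro!: continuous_intros)

lemma matrix_vector_mult_uminus: "(- A) *v x = - (A *v x :: real^'m::finite)"
  by (simp add: matrix_vector_mult_def vec_eq_iff sum_negf)

lemma inner_transpose_mult_vector: "x \<bullet> (transpose A *v y) = (A *v x) \<bullet> (y :: real^'m::finite)"
  by (metis dot_lmul_matrix inner_commute transpose_matrix_vector)

lemma matrix_family_bounded:
  fixes A :: "'a::topological_space \<Rightarrow> real^'n::finite^'m::finite"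
  assumes "continuous_on S A" "compact S"
  obtains M where "M \<ge> 0" "\<And>s y. s \<in> S \<Longrightarrow> norm (A s *v y) \<le> M * norm y"
proof -
  obtain B where B: "\<And>s. s \<in> S \<Longrightarrow> norm (A s) \<le> B"
    using compact_imp_bounded[OF compact_continuous_image[OF assms]] by (auto simp: bounded_iff)
  obtain K where K: "\<And>(a::real^'n^'m) b. norm (a *v b) \<le> norm a * norm b * K" "K > 0"
    using bounded_bilinear.pos_bounded[OF bounded_bilinear_matrix_vector_mult] by blast
  show ?thesis
  proof
    show "max B 0 * K \<ge> 0" using K by simp
    fix s y assume "s \<in> S"
    have "norm (A s *v y) \<le> norm (A s) * norm y * K" by (rule K(1))
    also have "\<dots> \<le> max B 0 * norm y * K"
      using B[OF \<open>s \<in> S\<close>] K(2) by (intro mult_right_mono) auto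
    finally show "norm (A s *v y) \<le> max B 0 * K * norm y" by (simp add: ac_simps)
  qed
qed

lemma sum_UNIV_prod:
  "(\<Sum>ij\<in>(UNIV::('a::finite \<times> 'b::finite) set). f ij) = (\<Sum>i\<in>UNIV. \<Sum>j\<in>UNIV. f (i, j))"
  by (simp add: sum.cartesian_product)

section \<open>Linear differential equations with continuous coefficients\<close>

primrec picard :: "(real \<Rightarrow> real^'k::finite^'k) \<Rightarrow> real \<Rightarrow> real^'k \<Rightarrow> nat \<Rightarrow> real \<Rightarrow> real^'k" where
  "picard A t0 x0 0 = (\<lambda>t. x0)"
| "picard A t0 x0 (Suc n) = (\<lambda>t. x0 + integral {t0..t} (\<lambda>s. A s *v picard A t0 x0 n s))"

text \<open>The limit is written as a telescoping series so that the Weierstrass M-test applies.\<close>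

definition picard_limit :: "(real \<Rightarrow> real^'k::finite^'k) \<Rightarrow> real \<Rightarrow> real^'k \<Rightarrow> real \<Rightarrow> real^'k" where
  "picard_limit A t0 x0 t = x0 + (\<Sum>n. picard A t0 x0 (Suc n) t - picard A t0 x0 n t)"

lemma continuous_on_picard:
  assumes "continuous_on {t0..N} A"
  shows "continuous_on {t0..N} (picard A t0 x0 n)"
proof (induction n)
  case 0
  then show ?case by simp
next
  case (Suc n)
  have "(\<lambda>s. A s *v picard A t0 x0 n s) integrable_on {t0..N}"
    by (intro integrable_continuous_real continuous_intros assms Suc)
  then show ?case
    by (auto intro!: continuous_intros indefinite_integral_continuous_1)
qed

lemma has_integral_power_shift:
  fixes t0 t :: real
  assumes "t0 \<le> t"
  shows "((\<lambda>s. (s - t0) ^ k) has_integral (t - t0) ^ Suc k / Suc k) {t0..t}"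
proof -
  have "((\<lambda>s. (s - t0) ^ k) has_integral (t - t0) ^ Suc k / Suc k - (t0 - t0) ^ Suc k / Suc k) {t0..t}"
  proof (rule fundamental_theorem_of_calculus[OF assms])
    fix x
    have "((\<lambda>s. (s - t0) ^ Suc k / Suc k) has_real_derivative (Suc k * (x - t0) ^ k * 1 / Suc k))
        (at x within {t0..t})"
      by (intro derivative_eq_intros) auto
    then show "((\<lambda>s. (s - t0) ^ Suc k / Suc k) has_vector_derivative (x - t0) ^ k) (at x within {t0..t})"
      by (simp add: has_real_derivative_iff_has_vector_derivative)
  qed
  then show ?thesis by simp
qed

lemma norm_picard_diff_le:
  assumes A: "continuous_on {t0..N} A"
    and M: "\<And>s y. s \<in> {t0..N} \<Longrightarrow> norm (A s *v y) \<le> M * norm y" "M \<ge> 0"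
    and t: "t \<in> {t0..N}"
  shows "norm (picard A t0 x0 (Suc n) t - picard A t0 x0 n t)
           \<le> norm x0 * (M * (t - t0)) ^ Suc n / fact (Suc n)"
proof -
  have integrable: "(\<lambda>s. A s *v y s) integrable_on {t0..t}"
    if "continuous_on {t0..N} y" "t \<in> {t0..N}" for y t
    using that by (intro integrable_continuous_real continuous_intros A that
        continuous_on_subset[of "{t0..N}"]) auto
  show ?thesis
    using t
  proof (induction n arbitrary: t)
    case 0
    have "norm (integral {t0..t} (\<lambda>s. A s *v x0)) \<le> integral {t0..t} (\<lambda>s. M * norm x0)"
      using 0 M(1) integrable[of "\<lambda>s. x0"] by (intro integral_norm_bound_integral) auto
    then show ?case using 0 by (simp add: mult_ac)
  next
    case (Suc n)
    let ?d = "\<lambda>s. picard A t0 x0 (Suc n) s - picard A t0 x0 n s"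
    define c where "c = M * norm x0 * M ^ Suc n / fact (Suc n)"
    have cont: "continuous_on {t0..N} (picard A t0 x0 (Suc n))" "continuous_on {t0..N} (picard A t0 x0 n)"
      by (rule continuous_on_picard[OF A])+
    have increment: "picard A t0 x0 (Suc (Suc n)) t - picard A t0 x0 (Suc n) t
        = integral {t0..t} (\<lambda>s. A s *v ?d s)"
      using integral_diff[OF integrable[OF cont(1) Suc.prems] integrable[OF cont(2) Suc.prems]]
      by (simp add: matrix_vector_mult_diff_distrib)
    have c_integral: "((\<lambda>s. c * (s - t0) ^ Suc n) has_integral
        c * ((t - t0) ^ Suc (Suc n) / Suc (Suc n))) {t0..t}"
      using Suc.prems by (intro has_integral_mult_right has_integral_power_shift) auto
    have "norm (integral {t0..t} (\<lambda>s. A s *v ?d s)) \<le> integral {t0..t} (\<lambda>s. c * (s - t0) ^ Suc n)"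
    proof (rule integral_norm_bound_integral)
      show "(\<lambda>s. A s *v ?d s) integrable_on {t0..t}"
        using cont Suc.prems by (intro integrable continuous_on_diff)
      show "(\<lambda>s. c * (s - t0) ^ Suc n) integrable_on {t0..t}"
        using c_integral by blast
    next
      fix s assume "s \<in> {t0..t}"
      then have s: "s \<in> {t0..N}" using Suc.prems by auto
      have "norm (A s *v ?d s) \<le> M * norm (?d s)" using M(1)[OF s] .
      also have "\<dots> \<le> M * (norm x0 * (M * (s - t0)) ^ Suc n / fact (Suc n))"
        by (rule mult_left_mono[OF Suc.IH[OF s] M(2)])
      also have "\<dots> = c * (s - t0) ^ Suc n" by (simp add: c_def power_mult_distrib)
      finally show "norm (A s *v ?d s) \<le> c * (s - t0) ^ Suc n" .
    qed
    also have "\<dots> = c * ((t - t0) ^ Suc (Suc n) / Suc (Suc n))"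
      using c_integral by (rule integral_unique)
    also have "\<dots> = norm x0 * (M * (t - t0)) ^ Suc (Suc n) / fact (Suc (Suc n))"
      unfolding c_def power_mult_distrib fact_Suc[of "Suc n"] by (simp add: field_simps)
    finally show ?case
      by (simp only: increment)
  qed
qed

lemma uniform_limit_picard:
  assumes A: "continuous_on {t0..N} A"
  shows "uniform_limit {t0..N} (picard A t0 x0) (picard_limit A t0 x0) sequentially"
proof -
  obtain M where M: "\<And>s y. s \<in> {t0..N} \<Longrightarrow> norm (A s *v y) \<le> M * norm y" "M \<ge> 0"
    using matrix_family_bounded[OF A compact_Icc] by blast
  let ?b = "\<lambda>n. norm x0 * (M * (N - t0)) ^ Suc n / fact (Suc n)"
  have bound: "norm (picard A t0 x0 (Suc n) t - picard A t0 x0 n t) \<le> ?b n" if t: "t \<in> {t0..N}" for n t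
  proof -
    have "norm (picard A t0 x0 (Suc n) t - picard A t0 x0 n t) \<le> norm x0 * (M * (t - t0)) ^ Suc n / fact (Suc n)"
      by (rule norm_picard_diff_le[OF A M t])
    also have "\<dots> \<le> ?b n"
      using t M(2) by (intro divide_right_mono mult_left_mono power_mono) auto
    finally show ?thesis .
  qed
  have "summable (\<lambda>n. (M * (N - t0)) ^ n / fact n)"
    using summable_exp[of "M * (N - t0)"] by (simp add: divide_inverse mult.commute)
  then have "summable (\<lambda>n. (M * (N - t0)) ^ Suc n / fact (Suc n))"
    by (subst summable_Suc_iff)
  from summable_mult[OF this, of "norm x0"] have summable: "summable ?b"
    by (simp only: times_divide_eq_right)
  have "uniform_limit {t0..N} (\<lambda>n t. \<Sum>i<n. picard A t0 x0 (Suc i) t - picard A t0 x0 i t)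
      (\<lambda>t. \<Sum>i. picard A t0 x0 (Suc i) t - picard A t0 x0 i t) sequentially"
    by (rule Weierstrass_m_test[OF bound summable])
  moreover have "dist (picard A t0 x0 n t) (picard_limit A t0 x0 t)
      = dist (\<Sum>i<n. picard A t0 x0 (Suc i) t - picard A t0 x0 i t)
             (\<Sum>i. picard A t0 x0 (Suc i) t - picard A t0 x0 i t)" for n t
  proof -
    have "picard A t0 x0 n t = x0 + (\<Sum>i<n. picard A t0 x0 (Suc i) t - picard A t0 x0 i t)"
      by (subst sum_lessThan_telescope) simp
    then show ?thesis by (simp only: picard_limit_def dist_add_cancel)
  qed
  ultimately show ?thesis
    unfolding uniform_limit_iff by simp
qed

lemma picard_limit_integral_equation:
  assumes A: "continuous_on {t0..N} A" and t: "t \<in> {t0..N}"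
  shows "picard_limit A t0 x0 t = x0 + integral {t0..t} (\<lambda>s. A s *v picard_limit A t0 x0 s)"
proof -
  let ?P = "picard A t0 x0" and ?X = "picard_limit A t0 x0"
  have sub: "{t0..t} \<subseteq> {t0..N}" using t by auto
  have P_limit: "uniform_limit {t0..t} ?P ?X sequentially"
    by (rule uniform_limit_on_subset[OF uniform_limit_picard[OF A] sub])
  have cont_P: "continuous_on {t0..t} (?P n)" for n
    by (rule continuous_on_subset[OF continuous_on_picard[OF A] sub])
  have cont_X: "continuous_on {t0..t} ?X"
    by (rule uniform_limit_theorem[OF _ P_limit]) (simp_all add: cont_P)
  have cont_A: "continuous_on {t0..t} A"
    by (rule continuous_on_subset[OF A sub])
  have "uniform_limit {t0..t} (\<lambda>n s. A s *v ?P n s) (\<lambda>s. A s *v ?X s) sequentially"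
    using cont_A cont_X
    by (intro bounded_bilinear.bounded_uniform_limit[OF bounded_bilinear_matrix_vector_mult]
        uniform_limit_const P_limit compact_imp_bounded compact_continuous_image) auto
  then obtain I J where I: "\<And>n. ((\<lambda>s. A s *v ?P n s) has_integral I n) {t0..t}"
    and J: "((\<lambda>s. A s *v ?X s) has_integral J) {t0..t}" and "I \<longlonglongrightarrow> J"
    by (rule uniform_limit_integral) (auto intro!: continuous_intros cont_A cont_P)
  then have "(\<lambda>n. ?P (Suc n) t) \<longlonglongrightarrow> x0 + J"
    using integral_unique[OF I] by (simp add: tendsto_add)
  moreover have "(\<lambda>n. ?P (Suc n) t) \<longlonglongrightarrow> ?X t"
    using LIMSEQ_Suc[OF tendsto_uniform_limitI[OF P_limit]] t by simp
  ultimately show ?thesis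
    using LIMSEQ_unique integral_unique[OF J] by metis
qed

lemma continuous_on_picard_limit:
  assumes "continuous_on {t0..N} A"
  shows "continuous_on {t0..N} (picard_limit A t0 x0)"
  by (rule uniform_limit_theorem[OF _ uniform_limit_picard[OF assms]])
    (simp_all add: continuous_on_picard[OF assms])

lemma linear_ode_exists:
  fixes A :: "real \<Rightarrow> real^'k::finite^'k"
  assumes A: "continuous_on {t0..} A"
  shows "\<exists>x. x t0 = x0 \<and> (\<forall>t\<ge>t0. (x has_vector_derivative A t *v x t) (at t within {t0..}))"
proof (intro exI[of _ "picard_limit A t0 x0"] conjI allI impI)
  let ?X = "picard_limit A t0 x0"
  have "picard A t0 x0 n t0 = x0" for n
    by (cases n) simp_all
  then show "?X t0 = x0"
    by (simp add: picard_limit_def)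
  fix t assume "t0 \<le> t"
  then have t: "t \<in> {t0..t + 1}" by simp
  have A': "continuous_on {t0..t + 1} A"
    by (rule continuous_on_subset[OF A]) auto
  have "((\<lambda>u. integral {t0..u} (\<lambda>s. A s *v ?X s)) has_vector_derivative A t *v ?X t)
      (at t within {t0..t + 1})"
    by (intro integral_has_vector_derivative continuous_intros A' continuous_on_picard_limit t)
  then have "((\<lambda>u. x0 + integral {t0..u} (\<lambda>s. A s *v ?X s)) has_vector_derivative A t *v ?X t)
      (at t within {t0..t + 1})"
    using has_vector_derivative_add[OF has_vector_derivative_const] by fastforce
  then have "(?X has_vector_derivative A t *v ?X t) (at t within {t0..t + 1})"
    using picard_limit_integral_equation[OF A'] by (rule has_vector_derivative_transform[OF t, rotated])
  moreover have "at t within {t0..t + 1} = at t within {t0..}"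
    by (rule at_within_nhd[where S = "{..<t + 1}"]) auto
  ultimately show "(?X has_vector_derivative A t *v ?X t) (at t within {t0..})"
    by simp
qed

section \<open>Exponential stability under persistent excitation\<close>

lemma loewner_leD: "loewner_le A B \<Longrightarrow> x \<bullet> (A *v x) \<le> x \<bullet> (B *v x)"
  by (auto simp: loewner_le_def matrix_vector_mult_diff_rdistrib inner_diff_right dest: spec[of _ x])

lemma has_integral_quadratic_form:
  fixes M :: "real \<Rightarrow> real^'k::finite^'k"
  assumes "M integrable_on S"
  shows "((\<lambda>\<tau>. x \<bullet> (M \<tau> *v x)) has_integral x \<bullet> (integral S M *v x)) S"
proof -
  have "bounded_linear (\<lambda>A :: real^'k^'k. x \<bullet> (A *v x))"
    by (intro bounded_linear_compose[OF bounded_linear_inner_right]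
        bounded_bilinear.bounded_linear_left[OF bounded_bilinear_matrix_vector_mult])
  from has_integral_linear[OF integrable_integral[OF assms] this] show ?thesis
    by (simp add: o_def)
qed

lemma has_integral_derivative_atLeast:
  fixes f :: "real \<Rightarrow> 'a::banach"
  assumes "\<And>\<tau>. t0 \<le> \<tau> \<Longrightarrow> (f has_vector_derivative f' \<tau>) (at \<tau> within {t0..})"
    and "t0 \<le> a" "a \<le> b"
  shows "(f' has_integral f b - f a) {a..b}"
  using assms by (intro fundamental_theorem_of_calculus has_vector_derivative_within_subset[OF assms(1)]) auto

lemma norm_integral_le_amgm:
  fixes f :: "real \<Rightarrow> 'a::euclidean_space"
  assumes f: "f integrable_on {a..b}" and q: "(q has_integral Q) {a..b}"
    and bound: "\<And>s. s \<in> {a..b} \<Longrightarrow> norm (f s) \<le> sqrt (q s)"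
    and "a \<le> b" "\<alpha> > 0"
  shows "norm (integral {a..b} f) \<le> (Q / \<alpha> + \<alpha> * (b - a)) / 2"
proof -
  have bound_integral: "((\<lambda>s. (q s / \<alpha> + \<alpha>) / 2) has_integral (Q / \<alpha> + \<alpha> * (b - a)) / 2) {a..b}"
    using has_integral_const_real[of \<alpha> a b] \<open>a \<le> b\<close>
    by (intro has_integral_divide has_integral_add q) (auto simp: mult.commute)
  have "norm (integral {a..b} f) \<le> integral {a..b} (\<lambda>s. (q s / \<alpha> + \<alpha>) / 2)"
  proof (rule integral_norm_bound_integral[OF f])
    show "(\<lambda>s. (q s / \<alpha> + \<alpha>) / 2) integrable_on {a..b}"
      using bound_integral by blast
    fix s assume s: "s \<in> {a..b}"
    have "q s \<ge> 0"
      using order_trans[OF norm_ge_zero bound[OF s]] by simp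
    moreover have "0 \<le> (sqrt (q s) - \<alpha>)\<^sup>2"
      by simp
    ultimately have "sqrt (q s) \<le> (q s / \<alpha> + \<alpha>) / 2"
      using \<open>\<alpha> > 0\<close> by (simp add: field_simps power2_eq_square)
    then show "norm (f s) \<le> (q s / \<alpha> + \<alpha>) / 2"
      using bound[OF s] by linarith
  qed
  also have "\<dots> = (Q / \<alpha> + \<alpha> * (b - a)) / 2"
    using bound_integral by (rule integral_unique)
  finally show ?thesis .
qed

text \<open>A Cauchy-Schwarz inequality: optimise \<open>\<alpha>\<close> in the previous bound.\<close>

lemma norm_integral_square_le:
  fixes f :: "real \<Rightarrow> 'a::euclidean_space"
  assumes f: "f integrable_on {a..b}" and q: "(q has_integral Q) {a..b}"
    and bound: "\<And>s. s \<in> {a..b} \<Longrightarrow> norm (f s) \<le> sqrt (q s)"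
  shows "(norm (integral {a..b} f))\<^sup>2 \<le> (b - a) * Q"
proof (cases "a < b")
  case False
  then have null: "Henstock_Kurzweil_Integration.content {a..b} = 0"
    by simp
  then have "Q = 0"
    using q has_integral_unique has_integral_null_real by blast
  moreover have "integral {a..b} f = 0"
    using null by (metis box_real(2) integral_null)
  ultimately show ?thesis
    by simp
next
  case True
  let ?x = "norm (integral {a..b} f)"
  have "q s \<ge> 0" if "s \<in> {a..b}" for s
    using order_trans[OF norm_ge_zero bound[OF that]] by simp
  then have "Q \<ge> 0"
    by (rule has_integral_nonneg[OF q])
  show ?thesis
  proof (cases "?x = 0")
    case True
    then show ?thesis
      using \<open>Q \<ge> 0\<close> \<open>a < b\<close> by simp
  next
    case False
    then have "?x \<le> (Q * (b - a) / ?x + ?x) / 2"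
      using norm_integral_le_amgm[OF f q bound, of "?x / (b - a)"] \<open>a < b\<close> by simp
    then show ?thesis
      using False by (simp add: field_simps power2_eq_square)
  qed
qed

lemma exp_decay_of_window_contraction:
  fixes V :: "real \<Rightarrow> real"
  assumes mono: "\<And>s t. t0 \<le> s \<Longrightarrow> s \<le> t \<Longrightarrow> V t \<le> V s"
    and contraction: "\<And>t. t0 \<le> t \<Longrightarrow> V (t + T) \<le> \<rho> * V t"
    and T: "T > 0" and \<rho>: "0 < \<rho>" "\<rho> \<le> 1" and "0 \<le> V t0" and t: "t0 \<le> t"
  shows "V t \<le> V t0 / \<rho> * exp (ln \<rho> / T * (t - t0))"
proof -
  have iterate: "V (t0 + j * T + s) \<le> \<rho> ^ j * V t0" if "s \<ge> 0" for j :: nat and s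
  proof (induction j)
    case 0
    then show ?case
      using mono[of t0 "t0 + s"] that by simp
  next
    case (Suc j)
    have "V (t0 + Suc j * T + s) = V ((t0 + j * T + s) + T)"
      by (simp add: algebra_simps)
    also have "\<dots> \<le> \<rho> * V (t0 + j * T + s)"
      using that T by (intro contraction) simp
    also have "\<dots> \<le> \<rho> * (\<rho> ^ j * V t0)"
      using Suc \<rho> by simp
    finally show ?case
      by simp
  qed
  define j where "j = nat \<lfloor>(t - t0) / T\<rfloor>"
  have j: "j \<le> (t - t0) / T" "(t - t0) / T - 1 \<le> j"
    using t T by (simp_all add: j_def)
  have "V t \<le> \<rho> ^ j * V t0"
    using iterate[of "t - t0 - j * T" j] j(1) T by (simp add: field_simps)
  also have "\<rho> ^ j = exp (j * ln \<rho>)"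
    using \<rho> by (simp add: exp_of_nat_mult)
  also have "\<dots> \<le> exp (((t - t0) / T - 1) * ln \<rho>)"
    using j(2) \<rho> by (simp add: mult_right_mono_neg)
  also have "\<dots> = exp (ln \<rho> / T * (t - t0)) / \<rho>"
    using \<rho> by (simp add: algebra_simps exp_diff)
  finally show ?thesis
    using \<open>0 \<le> V t0\<close> by (simp add: mult_right_mono ac_simps)
qed

text \<open>With \<open>H = Hbar\<close> and \<open>P t = Pi_blk (bearings (p t))\<close> this is the error dynamics of the
  estimator, since then \<open>transpose H ** P t ** H\<close> is the bearing Laplacian.\<close>

locale projected_laplacian_flow =
  fixes H :: "real^'k::finite^'e::finite" and P :: "real \<Rightarrow> real^'e^'e"
    and t0 :: real and w :: "real \<Rightarrow> real^'k"
  assumes flow: "\<And>\<tau>. t0 \<le> \<tau> \<Longrightarrow>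
      (w has_vector_derivative - (transpose H *v (P \<tau> *v (H *v w \<tau>)))) (at \<tau> within {t0..})"
    and inner_P_self: "\<And>\<tau> y. t0 \<le> \<tau> \<Longrightarrow> y \<bullet> (P \<tau> *v y) = (norm (P \<tau> *v y))\<^sup>2"
    and norm_P_le: "\<And>\<tau> y. t0 \<le> \<tau> \<Longrightarrow> norm (P \<tau> *v y) \<le> norm y"
begin

lemma has_integral_dissipation:
  assumes "t0 \<le> a" "a \<le> b"
  shows "((\<lambda>\<tau>. (norm (P \<tau> *v (H *v w \<tau>)))\<^sup>2) has_integral ((norm (w a))\<^sup>2 - (norm (w b))\<^sup>2) / 2) {a..b}"
proof -
  have "((\<lambda>\<tau>. (norm (w \<tau>))\<^sup>2) has_vector_derivative -2 * (norm (P \<tau> *v (H *v w \<tau>)))\<^sup>2)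
      (at \<tau> within {t0..})" if "t0 \<le> \<tau>" for \<tau>
    using bounded_bilinear.has_vector_derivative[OF bounded_bilinear_inner flow[OF that] flow[OF that]]
      inner_P_self[OF that, of "H *v w \<tau>"]
    by (simp add: power2_norm_eq_inner inner_transpose_mult_vector inner_commute)
  then have "((\<lambda>\<tau>. -2 * (norm (P \<tau> *v (H *v w \<tau>)))\<^sup>2) has_integral (norm (w b))\<^sup>2 - (norm (w a))\<^sup>2) {a..b}"
    by (rule has_integral_derivative_atLeast[OF _ assms])
  from has_integral_mult_right[OF this, of "-1/2"]
  have "((\<lambda>\<tau>. (norm (P \<tau> *v (H *v w \<tau>)))\<^sup>2) has_integral - (((norm (w b))\<^sup>2 - (norm (w a))\<^sup>2) / 2)) {a..b}"
    by simp
  then show ?thesis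
    by (simp only: minus_divide_left minus_diff_eq)
qed

lemma norm_antimono:
  assumes "t0 \<le> a" "a \<le> b"
  shows "norm (w b) \<le> norm (w a)"
  using has_integral_nonneg[OF has_integral_dissipation[OF assms]] by (simp add: power_mono_iff)

lemma norm_diff_square_le:
  assumes "t0 \<le> a" "a \<le> b"
  shows "(norm (w b - w a))\<^sup>2 \<le> (onorm ((*v) (transpose H)))\<^sup>2 * (b - a) * (((norm (w a))\<^sup>2 - (norm (w b))\<^sup>2) / 2)"
proof -
  let ?K = "onorm ((*v) (transpose H))"
  have increment: "w b - w a = integral {a..b} (\<lambda>\<tau>. - (transpose H *v (P \<tau> *v (H *v w \<tau>))))"
    by (rule integral_unique[OF has_integral_derivative_atLeast[OF flow assms], symmetric])
  have "(norm (w b - w a))\<^sup>2 \<le> (b - a) * (?K\<^sup>2 * (((norm (w a))\<^sup>2 - (norm (w b))\<^sup>2) / 2))"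
    unfolding increment
  proof (rule norm_integral_square_le)
    show "(\<lambda>\<tau>. - (transpose H *v (P \<tau> *v (H *v w \<tau>)))) integrable_on {a..b}"
      using has_integral_derivative_atLeast[OF flow assms] by blast
    show "((\<lambda>\<tau>. ?K\<^sup>2 * (norm (P \<tau> *v (H *v w \<tau>)))\<^sup>2) has_integral
        ?K\<^sup>2 * (((norm (w a))\<^sup>2 - (norm (w b))\<^sup>2) / 2)) {a..b}"
      by (intro has_integral_mult_right has_integral_dissipation assms)
    fix \<tau>
    have "norm (transpose H *v y) \<le> ?K * norm y" for y
      by (rule onorm[OF matrix_vector_mul_bounded_linear])
    then show "norm (- (transpose H *v (P \<tau> *v (H *v w \<tau>)))) \<le> sqrt (?K\<^sup>2 * (norm (P \<tau> *v (H *v w \<tau>)))\<^sup>2)"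
      by (simp add: real_sqrt_mult onorm_pos_le[OF matrix_vector_mul_bounded_linear])
  qed
  then show ?thesis
    by (simp add: ac_simps)
qed

lemma excitation_at_window_start_le:
  assumes "t0 \<le> t" "t \<le> \<tau>" "\<tau> \<le> t + T"
  shows "(norm (P \<tau> *v (H *v w t)))\<^sup>2 \<le> 2 * (norm (P \<tau> *v (H *v w \<tau>)))\<^sup>2
    + (onorm ((*v) H) * onorm ((*v) (transpose H)))\<^sup>2 * T * ((norm (w t))\<^sup>2 - (norm (w (t + T)))\<^sup>2)"
proof -
  let ?KH = "onorm ((*v) H)" and ?KT = "onorm ((*v) (transpose H))"
  let ?a = "norm (P \<tau> *v (H *v w \<tau>))" and ?b = "norm (P \<tau> *v (H *v (w t - w \<tau>)))"
  have "?b \<le> ?KH * norm (w \<tau> - w t)"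
    using norm_P_le[of \<tau> "H *v (w t - w \<tau>)"] onorm[OF matrix_vector_mul_bounded_linear, of H "w t - w \<tau>"] assms
    by (simp add: norm_minus_commute)
  then have "?b\<^sup>2 \<le> ?KH\<^sup>2 * (norm (w \<tau> - w t))\<^sup>2"
    by (metis norm_ge_zero power_mono power_mult_distrib)
  also have "\<dots> \<le> ?KH\<^sup>2 * (?KT\<^sup>2 * T * (((norm (w t))\<^sup>2 - (norm (w (t + T)))\<^sup>2) / 2))"
  proof (rule mult_left_mono)
    have "(norm (w \<tau> - w t))\<^sup>2 \<le> ?KT\<^sup>2 * (\<tau> - t) * (((norm (w t))\<^sup>2 - (norm (w \<tau>))\<^sup>2) / 2)"
      using assms by (intro norm_diff_square_le)
    also have "\<dots> \<le> ?KT\<^sup>2 * T * (((norm (w t))\<^sup>2 - (norm (w (t + T)))\<^sup>2) / 2)"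
      using assms norm_antimono[of \<tau> "t + T"] norm_antimono[of t \<tau>]
      by (intro mult_mono divide_right_mono) (auto simp: power_mono)
    finally show "(norm (w \<tau> - w t))\<^sup>2 \<le> ?KT\<^sup>2 * T * (((norm (w t))\<^sup>2 - (norm (w (t + T)))\<^sup>2) / 2)" .
  qed simp
  finally have b: "?b\<^sup>2 \<le> ?KH\<^sup>2 * (?KT\<^sup>2 * T * (((norm (w t))\<^sup>2 - (norm (w (t + T)))\<^sup>2) / 2))" .
  have "P \<tau> *v (H *v w t) = P \<tau> *v (H *v w \<tau>) + P \<tau> *v (H *v (w t - w \<tau>))"
    by (simp add: matrix_vector_right_distrib[symmetric])
  then have "norm (P \<tau> *v (H *v w t)) \<le> ?a + ?b"
    by (metis norm_triangle_ineq)
  then have "(norm (P \<tau> *v (H *v w t)))\<^sup>2 \<le> (?a + ?b)\<^sup>2"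
    by (simp add: power_mono)
  also have "\<dots> \<le> 2 * ?a\<^sup>2 + 2 * ?b\<^sup>2"
    using sum_squares_bound[of ?a ?b] by (simp add: power2_eq_square algebra_simps)
  finally show ?thesis
    using b by (simp add: power_mult_distrib)
qed

text \<open>Persistent excitation bounds the excitation of the state frozen at the start of the window;
  the previous lemma transfers this to the actual trajectory.\<close>

lemma excitation_le_energy_loss:
  assumes P_cont: "continuous_on {t..t + T} P"
    and PE: "loewner_le (\<mu> *\<^sub>R (transpose H ** H)) (integral {t..t + T} (\<lambda>\<tau>. transpose H ** P \<tau> ** H))"
    and t: "t0 \<le> t" and T: "0 \<le> T"
  shows "\<mu> * (norm (H *v w t))\<^sup>2 \<le> (1 + (onorm ((*v) H) * onorm ((*v) (transpose H)) * T)\<^sup>2)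
      * ((norm (w t))\<^sup>2 - (norm (w (t + T)))\<^sup>2)"
proof -
  let ?LB = "\<lambda>\<tau>. transpose H ** P \<tau> ** H" and ?K = "onorm ((*v) H) * onorm ((*v) (transpose H))"
  define E where "E = (norm (w t))\<^sup>2 - (norm (w (t + T)))\<^sup>2"
  have quadratic: "((\<lambda>\<tau>. w t \<bullet> (?LB \<tau> *v w t)) has_integral w t \<bullet> (integral {t..t + T} ?LB *v w t)) {t..t + T}"
    by (intro has_integral_quadratic_form integrable_continuous_real continuous_on_matrix_mult_sandwich P_cont)
  have bound: "((\<lambda>\<tau>. 2 * (norm (P \<tau> *v (H *v w \<tau>)))\<^sup>2 + ?K\<^sup>2 * T * E)
      has_integral 2 * (E / 2) + T * (?K\<^sup>2 * T * E)) {t..t + T}"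
    using has_integral_const_real[of "?K\<^sup>2 * T * E" t "t + T"] T unfolding E_def
    by (intro has_integral_add has_integral_mult_right has_integral_dissipation t) auto
  have pointwise: "w t \<bullet> (?LB \<tau> *v w t) \<le> 2 * (norm (P \<tau> *v (H *v w \<tau>)))\<^sup>2 + ?K\<^sup>2 * T * E"
    if "\<tau> \<in> {t..t + T}" for \<tau>
    using that t inner_P_self[of \<tau> "H *v w t"] excitation_at_window_start_le[of t \<tau> T] unfolding E_def
    by (simp add: matrix_vector_mul_assoc[symmetric] inner_transpose_mult_vector)
  have "\<mu> * (norm (H *v w t))\<^sup>2 \<le> w t \<bullet> (integral {t..t + T} ?LB *v w t)"
    using loewner_leD[OF PE, of "w t"]
    by (simp add: matrix_vector_mul_assoc[symmetric] inner_transpose_mult_vector power2_norm_eq_inner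
        scaleR_matrix_vector_assoc[symmetric])
  also have "\<dots> \<le> 2 * (E / 2) + T * (?K\<^sup>2 * T * E)"
    by (rule has_integral_le[OF quadratic bound pointwise])
  also have "\<dots> = (1 + (?K * T)\<^sup>2) * E"
    by (simp add: power_mult_distrib power2_eq_square algebra_simps)
  finally show ?thesis
    unfolding E_def by (simp add: mult.assoc)
qed

lemma window_contraction:
  assumes P_cont: "continuous_on {t..t + T} P"
    and PE: "loewner_le (\<mu> *\<^sub>R (transpose H ** H)) (integral {t..t + T} (\<lambda>\<tau>. transpose H ** P \<tau> ** H))"
    and t: "t0 \<le> t" and T: "0 \<le> T"
    and coercive: "e * norm (w t) \<le> norm (H *v w t)" "0 \<le> e" and \<mu>: "0 \<le> \<mu>"
  shows "(norm (w (t + T)))\<^sup>2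
      \<le> (1 - \<mu> * e\<^sup>2 / (1 + (onorm ((*v) H) * onorm ((*v) (transpose H)) * T)\<^sup>2)) * (norm (w t))\<^sup>2"
proof -
  let ?c = "1 + (onorm ((*v) H) * onorm ((*v) (transpose H)) * T)\<^sup>2"
  have c: "?c > 0"
    by (simp add: add_pos_nonneg)
  have "(e * norm (w t))\<^sup>2 \<le> (norm (H *v w t))\<^sup>2"
    using coercive by (intro power_mono) auto
  then have "\<mu> * e\<^sup>2 * (norm (w t))\<^sup>2 \<le> \<mu> * (norm (H *v w t))\<^sup>2"
    using \<mu> by (simp add: mult_left_mono power_mult_distrib mult.assoc)
  also have "\<dots> \<le> ?c * ((norm (w t))\<^sup>2 - (norm (w (t + T)))\<^sup>2)"
    by (rule excitation_le_energy_loss[OF P_cont PE t T])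
  finally have "\<mu> * e\<^sup>2 / ?c * (norm (w t))\<^sup>2 \<le> (norm (w t))\<^sup>2 - (norm (w (t + T)))\<^sup>2"
    using c by (simp add: pos_divide_le_eq mult.commute mult.left_commute)
  then show ?thesis
    by (simp add: algebra_simps)
qed

lemma energy_exp_decay:
  assumes P_cont: "continuous_on {t0..} P"
    and PE: "\<And>t. t0 \<le> t \<Longrightarrow>
      loewner_le (\<mu> *\<^sub>R (transpose H ** H)) (integral {t..t + T} (\<lambda>\<tau>. transpose H ** P \<tau> ** H))"
    and coercive: "\<And>\<tau>. t0 \<le> \<tau> \<Longrightarrow> e * norm (w \<tau>) \<le> norm (H *v w \<tau>)" "0 \<le> e"
    and \<mu>: "0 \<le> \<mu>" and T: "T > 0"
    and \<rho>: "1 - \<mu> * e\<^sup>2 / (1 + (onorm ((*v) H) * onorm ((*v) (transpose H)) * T)\<^sup>2) \<le> \<rho>" "0 < \<rho>" "\<rho> \<le> 1"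
    and t: "t0 \<le> t"
  shows "(norm (w t))\<^sup>2 \<le> (norm (w t0))\<^sup>2 / \<rho> * exp (ln \<rho> / T * (t - t0))"
proof (rule exp_decay_of_window_contraction[OF _ _ T \<rho>(2,3) _ t])
  show "(norm (w b))\<^sup>2 \<le> (norm (w a))\<^sup>2" if "t0 \<le> a" "a \<le> b" for a b
    using norm_antimono[OF that] by (simp add: power_mono)
  fix s assume s: "t0 \<le> s"
  have "(norm (w (s + T)))\<^sup>2
      \<le> (1 - \<mu> * e\<^sup>2 / (1 + (onorm ((*v) H) * onorm ((*v) (transpose H)) * T)\<^sup>2)) * (norm (w s))\<^sup>2"
    using s T \<mu> coercive
    by (intro window_contraction continuous_on_subset[OF P_cont] PE) auto
  also have "\<dots> \<le> \<rho> * (norm (w s))\<^sup>2"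
    using \<rho>(1) by (rule mult_right_mono) simp
  finally show "(norm (w (s + T)))\<^sup>2 \<le> \<rho> * (norm (w s))\<^sup>2" .
qed simp

end

theorem projected_laplacian_flow_exponentially_stable:
  fixes H :: "real^'k::finite^'e::finite" and P :: "real \<Rightarrow> real^'e^'e"
  assumes inner_P_self: "\<And>\<tau> y. 0 \<le> \<tau> \<Longrightarrow> y \<bullet> (P \<tau> *v y) = (norm (P \<tau> *v y))\<^sup>2"
    and norm_P_le: "\<And>\<tau> y. 0 \<le> \<tau> \<Longrightarrow> norm (P \<tau> *v y) \<le> norm y"
    and P_cont: "continuous_on {0..} P"
    and PE: "\<And>t. 0 \<le> t \<Longrightarrow>
      loewner_le (\<mu> *\<^sub>R (transpose H ** H)) (integral {t..t + T} (\<lambda>\<tau>. transpose H ** P \<tau> ** H))"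
    and T: "T > 0" and \<mu>: "\<mu> > 0" and e: "e > 0"
  obtains \<kappa> lam where "\<kappa> > 0" "lam > 0"
    "\<And>t0 w t. 0 \<le> t0 \<Longrightarrow>
      (\<And>\<tau>. t0 \<le> \<tau> \<Longrightarrow> (w has_vector_derivative - (transpose H *v (P \<tau> *v (H *v w \<tau>)))) (at \<tau> within {t0..})) \<Longrightarrow>
      (\<And>\<tau>. t0 \<le> \<tau> \<Longrightarrow> e * norm (w \<tau>) \<le> norm (H *v w \<tau>)) \<Longrightarrow>
      t0 \<le> t \<Longrightarrow> norm (w t) \<le> \<kappa> * exp (- lam * (t - t0)) * norm (w t0)"
proof
  \<comment> \<open>The window estimate may be vacuous (its factor negative); clamping keeps \<open>\<rho>\<close> positive.\<close>
  define \<rho> where "\<rho> = max (1 - \<mu> * e\<^sup>2 / (1 + (onorm ((*v) H) * onorm ((*v) (transpose H)) * T)\<^sup>2)) (1 / 2)"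
  have \<rho>: "0 < \<rho>" "\<rho> < 1"
    using \<mu> e by (auto simp: \<rho>_def add_pos_nonneg)
  moreover have "ln \<rho> < 0"
    using \<rho> by simp
  ultimately show "1 / sqrt \<rho> > 0" "- ln \<rho> / (2 * T) > 0"
    using T by (simp_all add: divide_neg_pos)
  fix t0 w t
  assume t0: "0 \<le> t0" and t: "t0 \<le> t"
    and flow: "\<And>\<tau>. t0 \<le> \<tau> \<Longrightarrow> (w has_vector_derivative - (transpose H *v (P \<tau> *v (H *v w \<tau>)))) (at \<tau> within {t0..})"
    and coercive: "\<And>\<tau>. t0 \<le> \<tau> \<Longrightarrow> e * norm (w \<tau>) \<le> norm (H *v w \<tau>)"
  interpret projected_laplacian_flow H P t0 w
    using flow t0 inner_P_self norm_P_le by unfold_locales auto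
  have "(norm (w t))\<^sup>2 \<le> (norm (w t0))\<^sup>2 / \<rho> * exp (ln \<rho> / T * (t - t0))"
    using t0 \<mu> e \<rho> T coercive
    by (intro energy_exp_decay[where \<mu> = \<mu> and e = e and T = T] continuous_on_subset[OF P_cont] PE t)
      (auto simp: \<rho>_def)
  also have "\<dots> = (1 / sqrt \<rho> * exp (- (- ln \<rho> / (2 * T)) * (t - t0)) * norm (w t0))\<^sup>2"
    using \<rho> T by (simp add: power_mult_distrib field_simps flip: exp_of_nat_mult)
  finally show "norm (w t) \<le> 1 / sqrt \<rho> * exp (- (- ln \<rho> / (2 * T)) * (t - t0)) * norm (w t0)"
    by (rule power2_le_imp_le) (use \<rho> in simp)
qed

section \<open>Incidence and bearing projection matrices\<close>

text \<open>\<open>agent x k\<close> is the \<open>k\<close>-th block of \<open>x\<close>; below it is also applied to edge-indexed vectors.\<close>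

lemma inner_eq_sum_agent:
  fixes y z :: "real^('m::finite \<times> 'd::finite)"
  shows "y \<bullet> z = (\<Sum>k\<in>UNIV. agent y k \<bullet> agent z k)"
  by (simp add: inner_vec_def agent_def sum_UNIV_prod)

lemma Hbar_mult_vector:
  fixes x :: "real^('n::finite \<times> 'd::finite)" and src dst :: "'m::finite \<Rightarrow> 'n"
  assumes "src k \<noteq> dst k"
  shows "(Hbar src dst *v x) $ (k, a) = x $ (dst k, a) - x $ (src k, a)"
proof -
  have "(Hbar src dst *v x) $ (k, a) = (\<Sum>i\<in>UNIV. incidence src dst $ k $ i * x $ (i, a))"
    unfolding Hbar_def kron_id_def matrix_vector_mult_def sum_UNIV_prod
    by (simp add: if_distrib[of "\<lambda>r. _ * r * _"] eq_commute[of a] cong: if_cong)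
  also have "\<dots> = (\<Sum>i\<in>UNIV. (if i = dst k then x $ (i, a) else 0) - (if i = src k then x $ (i, a) else 0))"
    using assms by (intro sum.cong) (auto simp: incidence_def)
  finally show ?thesis
    by (simp add: sum_subtractf)
qed

lemma Hbar_ones_kron:
  fixes src dst :: "'m::finite \<Rightarrow> 'n::finite"
  assumes "\<And>k. src k \<noteq> dst k"
  shows "Hbar src dst *v (ones_kron c :: real^('n \<times> 'd::finite)) = 0"
  by (simp add: vec_eq_iff Hbar_mult_vector assms ones_kron_def)

lemma proj_perp_mult_vector: "proj_perp y *v u = u - (y \<bullet> u) *\<^sub>R y"
proof -
  have "(\<chi> a b. y $ a * y $ b) *v u = (y \<bullet> u) *\<^sub>R y"
    by (simp add: vec_eq_iff matrix_vector_mult_def inner_vec_def sum_distrib_left mult_ac)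
  then show ?thesis
    by (simp add: proj_perp_def matrix_vector_mult_diff_rdistrib)
qed

lemma agent_Pi_blk_mult_vector: "agent (Pi_blk g *v z) k = proj_perp (g $ k) *v agent z k"
proof -
  have "(Pi_blk g *v z) $ (k, a) =
      (\<Sum>l\<in>UNIV. if k = l then \<Sum>b\<in>UNIV. proj_perp (g $ k) $ a $ b * z $ (k, b) else 0)" for a
    unfolding Pi_blk_def matrix_vector_mult_def sum_UNIV_prod vec_lambda_beta fst_conv snd_conv
    by (rule sum.cong) auto
  then show ?thesis
    by (simp add: agent_def vec_eq_iff matrix_vector_mult_def)
qed

lemma
  fixes y u :: "real^'d::finite"
  assumes "norm y = 1"
  shows inner_proj_perp_self: "u \<bullet> (proj_perp y *v u) = (norm (proj_perp y *v u))\<^sup>2"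
    and norm_proj_perp_le: "norm (proj_perp y *v u) \<le> norm u"
proof -
  have "y \<bullet> y = 1"
    using assms by (simp add: norm_eq_sqrt_inner)
  then have "(proj_perp y *v u) \<bullet> (proj_perp y *v u) = u \<bullet> u - (y \<bullet> u)\<^sup>2"
    by (simp add: proj_perp_mult_vector inner_diff_left inner_diff_right power2_eq_square
        inner_commute algebra_simps)
  moreover have "u \<bullet> (proj_perp y *v u) = u \<bullet> u - (y \<bullet> u)\<^sup>2"
    by (simp add: proj_perp_mult_vector inner_diff_right power2_eq_square inner_commute)
  ultimately show "u \<bullet> (proj_perp y *v u) = (norm (proj_perp y *v u))\<^sup>2"
    and "norm (proj_perp y *v u) \<le> norm u"
    by (simp_all add: norm_le power2_norm_eq_inner)
qed

lemma
  fixes g :: "real^'d::finite^'m::finite"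
  assumes "\<And>k. norm (g $ k) = 1"
  shows inner_Pi_blk_self: "z \<bullet> (Pi_blk g *v z) = (norm (Pi_blk g *v z))\<^sup>2"
    and norm_Pi_blk_le: "norm (Pi_blk g *v z) \<le> norm z"
proof -
  show "z \<bullet> (Pi_blk g *v z) = (norm (Pi_blk g *v z))\<^sup>2"
    unfolding power2_norm_eq_inner inner_eq_sum_agent[of z] inner_eq_sum_agent[of "Pi_blk g *v z"]
      agent_Pi_blk_mult_vector
    using inner_proj_perp_self[OF assms] by (simp add: power2_norm_eq_inner)
  have "(norm (Pi_blk g *v z))\<^sup>2 \<le> (norm z)\<^sup>2"
    unfolding power2_norm_eq_inner inner_eq_sum_agent[of z] inner_eq_sum_agent[of "Pi_blk g *v z"]
      agent_Pi_blk_mult_vector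
    using norm_proj_perp_le[OF assms]
    by (intro sum_mono) (simp add: power_mono norm_ge_zero flip: power2_norm_eq_inner)
  then show "norm (Pi_blk g *v z) \<le> norm z"
    by (simp add: power_mono_iff)
qed

lemma norm_bearings:
  assumes "edge_vec src dst p $ k \<noteq> 0"
  shows "norm (bearings src dst p $ k) = 1"
  using assms by (simp add: bearings_def)

lemma agent_Hbar_mult_vector: "agent (Hbar src dst *v p) k = edge_vec src dst p $ k"
  by (simp add: agent_def edge_vec_def)

lemma Pi_blk_bearings_edges:
  fixes p :: "real^('n::finite \<times> 'd::finite)" and src dst :: "'m::finite \<Rightarrow> 'n"
  assumes "\<And>k. edge_vec src dst p $ k \<noteq> 0"
  shows "Pi_blk (bearings src dst p) *v (Hbar src dst *v p) = 0"
proof -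
  have "proj_perp ((1 / norm e) *\<^sub>R e) *v e = 0" if "e \<noteq> 0" for e :: "real^'d"
    using that by (simp add: proj_perp_mult_vector dot_square_norm power2_eq_square)
  then have "agent (Pi_blk (bearings src dst p) *v (Hbar src dst *v p)) k = 0" for k
    using assms by (simp add: agent_Pi_blk_mult_vector agent_Hbar_mult_vector bearings_def)
  then show ?thesis
    by (simp add: agent_def vec_eq_iff)
qed

lemma bearing_Lap_mult_vector:
  "bearing_Lap src dst g *v z = transpose (Hbar src dst) *v (Pi_blk g *v (Hbar src dst *v z))"
  by (simp add: bearing_Lap_def matrix_vector_mul_assoc matrix_mul_assoc)

lemma bearing_Lap_mult_configuration:
  fixes p :: "real^('n::finite \<times> 'd::finite)" and src dst :: "'m::finite \<Rightarrow> 'n"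
  assumes "\<And>k. edge_vec src dst p $ k \<noteq> 0"
  shows "bearing_Lap src dst (bearings src dst p) *v p = 0"
  using assms by (simp add: bearing_Lap_mult_vector Pi_blk_bearings_edges)

lemma bearing_Lap_mult_ones_kron:
  fixes src dst :: "'m::finite \<Rightarrow> 'n::finite"
  assumes "\<And>k. src k \<noteq> dst k"
  shows "bearing_Lap src dst g *v (ones_kron c :: real^('n \<times> 'd::finite)) = 0"
  using assms by (simp add: bearing_Lap_mult_vector Hbar_ones_kron)

lemma continuous_on_Pi_blk_bearings:
  fixes p :: "real \<Rightarrow> real^('n::finite \<times> 'd::finite)" and src dst :: "'m::finite \<Rightarrow> 'n"
  assumes p: "continuous_on S p" and edges: "\<And>t k. t \<in> S \<Longrightarrow> edge_vec src dst (p t) $ k \<noteq> 0"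
  shows "continuous_on S (\<lambda>t. Pi_blk (bearings src dst (p t)))"
proof -
  have "continuous_on S (\<lambda>t. edge_vec src dst (p t))"
    unfolding edge_vec_def by (intro continuous_intros p)
  then have "continuous_on S (\<lambda>t. bearings src dst (p t))"
    unfolding bearings_def using edges by (auto intro!: continuous_intros)
  then have "continuous_on S (\<lambda>t. Pi_blk (bearings src dst (p t)) $ ka $ lb)" for ka lb
    by (cases "fst ka = fst lb") (auto simp: Pi_blk_def proj_perp_def intro!: continuous_intros)
  then have "continuous_on S (\<lambda>t. \<chi> ka lb. Pi_blk (bearings src dst (p t)) $ ka $ lb)"
    by (intro continuous_on_vec_lambda)
  then show ?thesis
    by simp
qed

section \<open>Centroid and the consensus subspace\<close>

definition centroid :: "real^('n::finite \<times> 'd::finite) \<Rightarrow> real^'d" where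
  "centroid x = (\<chi> a. (\<Sum>i\<in>UNIV. x $ (i, a)) / CARD('n))"

lemma linear_centroid: "linear centroid"
  by (rule linearI) (simp_all add: centroid_def vec_eq_iff sum.distrib sum_distrib_left add_divide_distrib)

lemma centroid_ones_kron: "centroid (ones_kron c :: real^('n::finite \<times> 'd::finite)) = c"
  by (simp add: centroid_def ones_kron_def vec_eq_iff)

lemma centroid_centred: "centroid (x - ones_kron (centroid x)) = 0"
  by (simp add: linear_diff[OF linear_centroid] centroid_ones_kron)

lemma inner_ones_kron_eq_centroid:
  fixes w :: "real^('n::finite \<times> 'd::finite)"
  shows "w \<bullet> ones_kron c = CARD('n) * (centroid w \<bullet> c)"
proof -
  have "w \<bullet> ones_kron c = (\<Sum>a\<in>UNIV. c $ a * (\<Sum>i\<in>UNIV. w $ (i, a)))"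
    by (simp add: inner_vec_def sum_UNIV_prod ones_kron_def sum_distrib_left mult.commute
        sum.swap[of _ "UNIV::'n set"])
  also have "\<dots> = (\<Sum>a\<in>UNIV. (CARD('n) * centroid w $ a) * c $ a)"
    by (simp add: centroid_def mult.commute)
  also have "\<dots> = CARD('n) * (centroid w \<bullet> c)"
    by (simp add: inner_vec_def sum_distrib_left mult.assoc)
  finally show ?thesis .
qed

lemma centroid_eq_0_iff: "centroid w = 0 \<longleftrightarrow> (\<forall>c. w \<bullet> ones_kron c = 0)"
  by (metis inner_eq_zero_iff inner_ones_kron_eq_centroid inner_zero_left mult_eq_0_iff of_nat_eq_0_iff
      zero_less_card_finite less_irrefl)

lemma infdist_range_ones_kron:
  fixes x :: "real^('n::finite \<times> 'd::finite)"
  shows "infdist x (range ones_kron) = norm (x - ones_kron (centroid x))"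
proof (rule antisym)
  show "infdist x (range ones_kron) \<le> norm (x - ones_kron (centroid x))"
    using infdist_le[OF rangeI, of x ones_kron "centroid x"] by (simp add: dist_norm)
  have "norm (x - ones_kron (centroid x)) \<le> norm (x - ones_kron c)" for c
  proof -
    have orth: "orthogonal (x - ones_kron (centroid x)) (ones_kron (centroid x - c))"
      using centroid_centred[of x] by (simp add: orthogonal_def centroid_eq_0_iff)
    have decomp: "x - ones_kron c = (x - ones_kron (centroid x)) + ones_kron (centroid x - c)"
      by (simp add: ones_kron_def vec_eq_iff)
    have "(norm (x - ones_kron c))\<^sup>2 =
        (norm (x - ones_kron (centroid x)))\<^sup>2 + (norm (ones_kron (centroid x - c) :: real^('n \<times> 'd)))\<^sup>2"
      unfolding decomp by (rule norm_add_Pythagorean[OF orth])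
    then show ?thesis
      by (simp add: power_mono_iff[symmetric, of _ _ 2])
  qed
  then show "norm (x - ones_kron (centroid x)) \<le> infdist x (range ones_kron)"
    by (auto simp: infdist_notempty dist_norm intro!: cINF_greatest)
qed

lemma centroid_transpose_mult_vector:
  fixes H :: "real^('n::finite \<times> 'd::finite)^'e::finite"
  assumes "\<And>c. H *v ones_kron c = 0"
  shows "centroid (transpose H *v y) = 0"
  using assms by (simp add: centroid_eq_0_iff inner_commute[of _ "ones_kron _"] inner_transpose_mult_vector
     )

lemma centroid_constant:
  fixes w :: "real \<Rightarrow> real^('n::finite \<times> 'd::finite)" and H :: "real^('n \<times> 'd)^'e::finite"
  assumes flow: "\<And>\<tau>. t0 \<le> \<tau> \<Longrightarrow> (w has_vector_derivative - (transpose H *v y \<tau>)) (at \<tau> within {t0..})"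
    and "\<And>c. H *v ones_kron c = 0" and "t0 \<le> t"
  shows "centroid (w t) = centroid (w t0)"
proof -
  have "((\<lambda>\<tau>. centroid (w \<tau>)) has_vector_derivative 0) (at \<tau> within {t0..})" if "t0 \<le> \<tau>" for \<tau>
    using bounded_linear.has_vector_derivative[OF linear_centroid[unfolded linear_conv_bounded_linear] flow[OF that]]
    by (simp add: linear_neg[OF linear_centroid] centroid_transpose_mult_vector[OF assms(2)]
       )
  from has_integral_derivative_atLeast[OF this order.refl \<open>t0 \<le> t\<close>]
  show ?thesis
    using has_integral_0 has_integral_unique by force
qed

lemma Hbar_kernel_eq_ones_kron:
  fixes src dst :: "'m::finite \<Rightarrow> 'n::finite" and w :: "real^('n \<times> 'd::finite)"
  assumes loopless: "\<And>k. src k \<noteq> dst k" and tree: "has_spanning_tree src dst"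
    and kernel: "Hbar src dst *v w = 0"
  shows "w = ones_kron (centroid w)"
proof -
  obtain S where "connects src dst S"
    using tree unfolding has_spanning_tree_def by blast
  define E where "E = {(src k, dst k) | k. k \<in> S} \<union> {(dst k, src k) | k. k \<in> S}"
  have edge: "w $ (dst k, a) = w $ (src k, a)" for k a
    using Hbar_mult_vector[of src k dst w a] loopless[of k] kernel by simp
  have "w $ (i, a) = w $ (j, a)" if "(i, j) \<in> E\<^sup>*" for i j a
    using that by (induction rule: rtrancl_induct) (auto simp: E_def edge)
  then have const: "w $ (i, a) = w $ (j, a)" for i j a
    using \<open>connects src dst S\<close> unfolding connects_def E_def by blast
  have "centroid w $ a = w $ (j, a)" for j a
  proof -
    have "(\<Sum>i\<in>UNIV. w $ (i, a)) = (\<Sum>i\<in>(UNIV::'n set). w $ (j, a))"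
      using const by (intro sum.cong) auto
    then show ?thesis
      by (simp add: centroid_def)
  qed
  then show ?thesis
    by (simp add: ones_kron_def vec_eq_iff)
qed

lemma Hbar_bounded_below:
  fixes src dst :: "'m::finite \<Rightarrow> 'n::finite"
  assumes "\<And>k. src k \<noteq> dst k" "has_spanning_tree src dst"
  obtains e where "e > 0"
    "\<And>w :: real^('n \<times> 'd::finite). centroid w = 0 \<Longrightarrow> e * norm w \<le> norm (Hbar src dst *v w)"
proof -
  let ?Z = "{w :: real^('n \<times> 'd). centroid w = 0}"
  have Z: "subspace ?Z"
    by (rule linear_subspace_kernel[OF linear_centroid])
  have "w = 0" if "w \<in> ?Z" "Hbar src dst *v w = 0" for w
  proof -
    have "w = ones_kron (centroid w)"
      by (rule Hbar_kernel_eq_ones_kron[OF assms that(2)])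
    also have "\<dots> = 0"
      using that(1) by (simp add: ones_kron_def vec_eq_iff)
    finally show ?thesis .
  qed
  then obtain e where "e > 0" "\<And>w. w \<in> ?Z \<Longrightarrow> e * norm w \<le> norm (Hbar src dst *v w)"
    using injective_imp_isometric[OF closed_subspace[OF Z] Z matrix_vector_mul_bounded_linear] by blast
  then show ?thesis
    using that by blast
qed

section \<open>The bearing-only estimator\<close>

definition bearing_estimator ::
  "('m::finite \<Rightarrow> 'n::finite) \<Rightarrow> ('m \<Rightarrow> 'n) \<Rightarrow> real^('n \<times> 'd::finite) \<Rightarrow> real^'d^'m \<Rightarrow> real^('n \<times> 'd) \<Rightarrow> real^('n \<times> 'd)"
  where "bearing_estimator src dst x g v = v - bearing_Lap src dst g *v x"

lemma bearing_estimator_error_flow: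
  fixes p x :: "real \<Rightarrow> real^('n::finite \<times> 'd::finite)" and src dst :: "'m::finite \<Rightarrow> 'n"
  assumes loopless: "\<And>k. src k \<noteq> dst k" and edges: "\<And>k. edge_vec src dst (p \<tau>) $ k \<noteq> 0"
    and p: "(p has_vector_derivative v) (at \<tau> within S)"
    and x: "(x has_vector_derivative bearing_estimator src dst (x \<tau>) (bearings src dst (p \<tau>)) v) (at \<tau> within S)"
  shows "((\<lambda>s. x s - (p s + ones_kron c)) has_vector_derivative
      - (transpose (Hbar src dst) *v (Pi_blk (bearings src dst (p \<tau>)) *v (Hbar src dst *v (x \<tau> - (p \<tau> + ones_kron c))))))
      (at \<tau> within S)"
proof -
  let ?LB = "bearing_Lap src dst (bearings src dst (p \<tau>))"
  have "((\<lambda>s. x s - (p s + ones_kron c)) has_vector_derivative - (?LB *v x \<tau>)) (at \<tau> within S)"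
    using has_vector_derivative_diff[OF x has_vector_derivative_add_const[THEN iffD2, OF p]]
    by (simp add: bearing_estimator_def)
  moreover have "?LB *v x \<tau> = ?LB *v (x \<tau> - (p \<tau> + ones_kron c))"
    using bearing_Lap_mult_configuration[OF edges] bearing_Lap_mult_ones_kron[OF loopless]
    by (simp add: matrix_vector_mult_diff_distrib matrix_vector_right_distrib)
  ultimately show ?thesis
    by (simp add: bearing_Lap_mult_vector)
qed

lemma bearing_estimator_solution_exists:
  fixes p :: "real \<Rightarrow> real^('n::finite \<times> 'd::finite)" and src dst :: "'m::finite \<Rightarrow> 'n"
  assumes loopless: "\<And>k. src k \<noteq> dst k"
    and p: "\<And>t. 0 \<le> t \<Longrightarrow> (p has_vector_derivative v t) (at t within {0..})"
    and edges: "\<And>t k. 0 \<le> t \<Longrightarrow> edge_vec src dst (p t) $ k \<noteq> 0"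
    and t0: "0 \<le> t0"
  shows "\<exists>x. x t0 = x0 \<and>
    (\<forall>t\<ge>t0. (x has_vector_derivative bearing_estimator src dst (x t) (bearings src dst (p t)) (v t)) (at t within {t0..}))"
proof -
  let ?LB = "\<lambda>t. bearing_Lap src dst (bearings src dst (p t))"
  have "continuous_on {t0..} p"
    using t0 by (intro has_derivative_continuous_on[where f' = "\<lambda>t h. h *\<^sub>R v t"])
      (auto simp flip: has_vector_derivative_def intro: has_vector_derivative_within_subset[OF p])
  then have "continuous_on {t0..} (\<lambda>t. - ?LB t)"
    unfolding bearing_Lap_def using t0 edges
    by (intro continuous_intros continuous_on_matrix_mult_sandwich continuous_on_Pi_blk_bearings) auto
  then obtain e where e0: "e t0 = x0 - p t0"
    and e: "\<And>t. t0 \<le> t \<Longrightarrow> (e has_vector_derivative - ?LB t *v e t) (at t within {t0..})"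
    using linear_ode_exists by blast
  show ?thesis
  proof (intro exI[of _ "\<lambda>t. p t + e t"] conjI allI impI)
    show "p t0 + e t0 = x0"
      using e0 by simp
    fix t assume t: "t0 \<le> t"
    have "((\<lambda>t. p t + e t) has_vector_derivative v t + - ?LB t *v e t) (at t within {t0..})"
      using t t0 by (intro has_vector_derivative_add e has_vector_derivative_within_subset[OF p]) auto
    moreover have "- ?LB t *v e t = - (?LB t *v (p t + e t))"
      using bearing_Lap_mult_configuration[of src dst "p t"] edges t t0
    by (simp add: matrix_vector_right_distrib matrix_vector_mult_uminus)
    ultimately show "((\<lambda>t. p t + e t) has_vector_derivative
        bearing_estimator src dst (p t + e t) (bearings src dst (p t)) (v t)) (at t within {t0..})"
      by (simp add: bearing_estimator_def)
  qed
qed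

lemma bearing_error_flow_exponentially_stable:
  fixes p :: "real \<Rightarrow> real^('n::finite \<times> 'd::finite)" and src dst :: "'m::finite \<Rightarrow> 'n"
  assumes loopless: "\<And>k. src k \<noteq> dst k"
    and p: "\<And>t. 0 \<le> t \<Longrightarrow> (p has_vector_derivative v t) (at t within {0..})"
    and edges: "\<And>t k. 0 \<le> t \<Longrightarrow> edge_vec src dst (p t) $ k \<noteq> 0"
    and BPE: "BPE src dst p"
  obtains \<kappa> lam where "\<kappa> > 0" "lam > 0"
    "\<And>t0 w t. 0 \<le> t0 \<Longrightarrow> (\<And>\<tau>. t0 \<le> \<tau> \<Longrightarrow> (w has_vector_derivative
        - (transpose (Hbar src dst) *v (Pi_blk (bearings src dst (p \<tau>)) *v (Hbar src dst *v w \<tau>))))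
        (at \<tau> within {t0..})) \<Longrightarrow>
      centroid (w t0) = 0 \<Longrightarrow> t0 \<le> t \<Longrightarrow> norm (w t) \<le> \<kappa> * exp (- lam * (t - t0)) * norm (w t0)"
proof -
  let ?H = "Hbar src dst :: real^('n \<times> 'd)^('m \<times> 'd)" and ?P = "\<lambda>\<tau>. Pi_blk (bearings src dst (p \<tau>))"
  obtain T \<mu> where T: "T > 0" and \<mu>: "\<mu> > 0" and PE: "\<And>t. 0 \<le> t \<Longrightarrow>
      loewner_le (\<mu> *\<^sub>R (transpose ?H ** ?H)) (integral {t..t + T} (\<lambda>\<tau>. transpose ?H ** ?P \<tau> ** ?H))"
    using BPE unfolding BPE_def bearing_PE_def Lap_def bearing_Lap_def by blast
  obtain e where e: "e > 0" and coercive: "\<And>w. centroid w = 0 \<Longrightarrow> e * norm w \<le> norm (?H *v w)"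
    using Hbar_bounded_below[of src dst, OF loopless] BPE unfolding BPE_def by blast
  have unit: "norm (bearings src dst (p \<tau>) $ k) = 1" if "0 \<le> \<tau>" for \<tau> k
    by (rule norm_bearings) (use edges that in auto)
  have "continuous_on {0..} p"
    using p by (intro has_derivative_continuous_on[where f' = "\<lambda>t h. h *\<^sub>R v t"])
      (auto simp flip: has_vector_derivative_def)
  then have P_cont: "continuous_on {0..} ?P"
    by (rule continuous_on_Pi_blk_bearings) (use edges in auto)
  obtain \<kappa> lam where \<kappa>: "\<kappa> > 0" and lam: "lam > 0" and stable: "\<And>t0 w t. 0 \<le> t0 \<Longrightarrow>
      (\<And>\<tau>. t0 \<le> \<tau> \<Longrightarrow> (w has_vector_derivative - (transpose ?H *v (?P \<tau> *v (?H *v w \<tau>)))) (at \<tau> within {t0..})) \<Longrightarrow>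
      (\<And>\<tau>. t0 \<le> \<tau> \<Longrightarrow> e * norm (w \<tau>) \<le> norm (?H *v w \<tau>)) \<Longrightarrow>
      t0 \<le> t \<Longrightarrow> norm (w t) \<le> \<kappa> * exp (- lam * (t - t0)) * norm (w t0)"
    using projected_laplacian_flow_exponentially_stable[OF inner_Pi_blk_self[OF unit]
        norm_Pi_blk_le[OF unit] P_cont PE T \<mu> e] by blast
  show ?thesis
  proof (rule that[OF \<kappa> lam])
    fix t0 w t
    assume t0: "0 \<le> t0" and t: "t0 \<le> t" and w0: "centroid (w t0) = 0"
      and flow: "\<And>\<tau>. t0 \<le> \<tau> \<Longrightarrow>
        (w has_vector_derivative - (transpose ?H *v (?P \<tau> *v (?H *v w \<tau>)))) (at \<tau> within {t0..})"
    show "norm (w t) \<le> \<kappa> * exp (- lam * (t - t0)) * norm (w t0)"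
    proof (rule stable[OF t0 flow _ t])
      fix \<tau> assume "t0 \<le> \<tau>"
      then have "centroid (w \<tau>) = 0"
        using centroid_constant[OF flow Hbar_ones_kron[OF loopless]] w0 by simp
      then show "e * norm (w \<tau>) \<le> norm (?H *v w \<tau>)"
        by (rule coercive)
    qed
  qed
qed

lemma bearing_estimator_converges:
  fixes p v :: "real \<Rightarrow> real^('n::finite \<times> 'd::finite)" and src dst :: "'m::finite \<Rightarrow> 'n"
  assumes loopless: "\<And>k. src k \<noteq> dst k"
    and p: "\<And>t. 0 \<le> t \<Longrightarrow> (p has_vector_derivative v t) (at t within {0..})"
    and edges: "\<And>t k. 0 \<le> t \<Longrightarrow> edge_vec src dst (p t) $ k \<noteq> 0"
    and BPE: "BPE src dst p"
  obtains \<kappa> lam where "\<kappa> > 0" "lam > 0"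
    "\<And>t0 x t. 0 \<le> t0 \<Longrightarrow>
      (\<And>\<tau>. t0 \<le> \<tau> \<Longrightarrow> (x has_vector_derivative
        bearing_estimator src dst (x \<tau>) (bearings src dst (p \<tau>)) (v \<tau>)) (at \<tau> within {t0..})) \<Longrightarrow>
      t0 \<le> t \<Longrightarrow> norm (x t - (p t + ones_kron (centroid (x t0 - p t0))))
        \<le> \<kappa> * exp (- lam * (t - t0)) * infdist (x t0 - p t0) (range ones_kron)"
proof (rule bearing_error_flow_exponentially_stable[OF loopless p edges BPE])
  fix \<kappa> lam :: real
  assume "\<kappa> > 0" "lam > 0" and stable: "\<And>t0 w t. 0 \<le> t0 \<Longrightarrow> (\<And>\<tau>. t0 \<le> \<tau> \<Longrightarrow> (w has_vector_derivative
        - (transpose (Hbar src dst) *v (Pi_blk (bearings src dst (p \<tau>)) *v (Hbar src dst *v w \<tau>))))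
        (at \<tau> within {t0..})) \<Longrightarrow>
      centroid (w t0) = 0 \<Longrightarrow> t0 \<le> t \<Longrightarrow> norm (w t) \<le> \<kappa> * exp (- lam * (t - t0)) * norm (w t0)"
  show ?thesis
  proof (rule that[OF \<open>\<kappa> > 0\<close> \<open>lam > 0\<close>])
    fix t0 x t
    assume t0: "0 \<le> t0" and t: "t0 \<le> t"
      and x: "\<And>\<tau>. t0 \<le> \<tau> \<Longrightarrow> (x has_vector_derivative
        bearing_estimator src dst (x \<tau>) (bearings src dst (p \<tau>)) (v \<tau>)) (at \<tau> within {t0..})"
    define w where "w s = x s - (p s + ones_kron (centroid (x t0 - p t0)))" for s
    have "norm (w t) \<le> \<kappa> * exp (- lam * (t - t0)) * norm (w t0)"
    proof (rule stable[OF t0 _ _ t])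
      show "(w has_vector_derivative - (transpose (Hbar src dst) *v
          (Pi_blk (bearings src dst (p \<tau>)) *v (Hbar src dst *v w \<tau>)))) (at \<tau> within {t0..})"
        if "t0 \<le> \<tau>" for \<tau>
        unfolding w_def using that t0
        by (intro bearing_estimator_error_flow[where v = "v \<tau>"] loopless edges x
            has_vector_derivative_within_subset[OF p]) auto
      show "centroid (w t0) = 0"
        using centroid_centred[of "x t0 - p t0"] by (simp add: w_def diff_diff_eq)
    qed
    then show "norm (x t - (p t + ones_kron (centroid (x t0 - p t0))))
        \<le> \<kappa> * exp (- lam * (t - t0)) * infdist (x t0 - p t0) (range ones_kron)"
      by (simp add: w_def infdist_range_ones_kron diff_diff_eq)
  qed
qed

theorem corollary1:
  fixes src dst :: "'m::finite \<Rightarrow> 'n::finite"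
  assumes d2: "CARD('d::finite) \<ge> 2"
    and n2: "CARD('n) \<ge> 2"
    and graph: "simple_undirected_graph src dst"
  shows "\<exists>F :: real^('n \<times> 'd) \<Rightarrow> real^'d^'m \<Rightarrow> real^('n \<times> 'd) \<Rightarrow> real^('n \<times> 'd).
    \<forall>(p :: real \<Rightarrow> real^('n \<times> 'd)) v.
      (\<forall>t\<ge>0. (p has_vector_derivative v t) (at t within {0..})) \<longrightarrow>
      (\<exists>B. \<forall>t\<ge>0. norm (v t) \<le> B) \<longrightarrow>
      (\<forall>t\<ge>0. \<forall>k. edge_vec src dst (p t) $ k \<noteq> 0) \<longrightarrow>
      relaxed_bearing_rigid src dst p \<longrightarrow>
      (\<exists>\<kappa> lam. \<kappa> > 0 \<and> lam > 0 \<and>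
        (\<forall>t0\<ge>0. \<forall>x0.
          (\<exists>x. x t0 = x0 \<and> (\<forall>t\<ge>t0. (x has_vector_derivative
                 F (x t) (bearings src dst (p t)) (v t)) (at t within {t0..}))) \<and>
          (\<forall>x. x t0 = x0 \<longrightarrow>
             (\<forall>t\<ge>t0. (x has_vector_derivative
                 F (x t) (bearings src dst (p t)) (v t)) (at t within {t0..})) \<longrightarrow>
             (\<exists>c. \<forall>t\<ge>t0. norm (x t - (p t + ones_kron c))
                  \<le> \<kappa> * exp (- lam * (t - t0)) * infdist (x0 - p t0) (range ones_kron)))))"
proof (intro exI[of _ "bearing_estimator src dst"] allI impI, goal_cases)
  case (1 p v)
  then have p: "\<And>t. 0 \<le> t \<Longrightarrow> (p has_vector_derivative v t) (at t within {0..})"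
    and edges: "\<And>t k. 0 \<le> t \<Longrightarrow> edge_vec src dst (p t) $ k \<noteq> 0"
    and "BPE src dst p"
    by (simp_all add: relaxed_bearing_rigid_def)
  have loopless: "\<And>k. src k \<noteq> dst k"
    using graph by (simp add: simple_undirected_graph_def)
  obtain \<kappa> lam where "\<kappa> > 0" "lam > 0" and converges: "\<And>t0 x t. 0 \<le> t0 \<Longrightarrow>
      (\<And>\<tau>. t0 \<le> \<tau> \<Longrightarrow> (x has_vector_derivative
        bearing_estimator src dst (x \<tau>) (bearings src dst (p \<tau>)) (v \<tau>)) (at \<tau> within {t0..})) \<Longrightarrow>
      t0 \<le> t \<Longrightarrow> norm (x t - (p t + ones_kron (centroid (x t0 - p t0))))
        \<le> \<kappa> * exp (- lam * (t - t0)) * infdist (x t0 - p t0) (range ones_kron)"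
    using bearing_estimator_converges[OF loopless p edges \<open>BPE src dst p\<close>] by blast
  show ?case
  proof (rule exI[of _ \<kappa>], rule exI[of _ lam], intro conjI allI impI, goal_cases)
    case (3 t0 x0)
    then show ?case
      using bearing_estimator_solution_exists[OF loopless p edges] by blast
  next
    case (4 t0 x0 x)
    then show ?case
      using converges[of t0 x] by blast
  qed (use \<open>\<kappa> > 0\<close> \<open>lam > 0\<close> in auto)
qed

end
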